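(* Let $\delta>0$, let $r_{\mathrm R}(x)=e^{-\delta x}$ for $x\ge0$, and let $r_{\mathrm L}$ on $(-\infty,0]$ be arbitrary as in the context. Suppose $\gamma=-\delta$. Then the unique solution $\eta^{\mathrm{opt}}\ge0$ of the threshold equation $r(\eta)=R_{\mathrm T}(\eta)$ is $$\eta^{\mathrm{opt}}=r_0+\frac1\delta W\Bigl(\frac{\delta e^{-\delta r_0}}{a_0}\Bigr),$$ with $$a_0=\frac{1}{\frac{\Phi(\gamma)}{\phi(\gamma)}-\frac1\delta},\qquad r_0=\frac1\delta-\frac{\Phi(\gamma)}{\phi(\gamma)}R_{\mathrm T}(0),$$ where $W$ denotes the Lambert W function.
   Context: $\phi,\Phi$ are the standard normal density and distribution function. $r:\mathbb{R}\to[0,1]$ equals $r_{\mathrm L}$ on $(-\infty,0]$ and $r_{\mathrm R}$ on $[0,\infty)$, where $r_{\mathrm L}:(-\infty,0]\to[0,1]$ is continuous, piecewise smooth, nondecreasing, with $r_{\mathrm L}(0)=1$ and $r_{\mathrm L}$ not identically $1$. For $\eta\ge0$, $$R_{\mathrm T}(\eta)=\frac{\int_{-\infty}^0 r_{\mathrm L}(x)e^{-\frac12x^2-\gamma x}\,dx+\int_0^\eta r(x)e^{-\gamma x}\,dx}{\frac{\Phi(\gamma)}{\phi(\gamma)}+\int_0^\eta e^{-\gamma x}\,dx}.$$ Lambert W function: $W(z)$ denotes a real number $w$ with $we^w=z$; of the two real branches, the one is taken for which the resulting value of $\eta^{\mathrm{opt}}$ is positive. *)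

theory Defs
  imports "HOL-Probability.Probability"
begin

abbreviation std_normal_cdf :: "real \<Rightarrow> real" where
  "std_normal_cdf \<equiv> cdf std_normal_distribution"

text \<open>Piecewise smoothness on the unbounded interval is read in its weakest sense: on every
  compact subinterval the function is \<open>C\<^sup>1\<close> away from finitely many points. Values of
  \<open>rL\<close> at positive arguments are irrelevant.\<close>

definition left_reward :: "(real \<Rightarrow> real) \<Rightarrow> bool" where
  "left_reward rL \<longleftrightarrow>
     rL \<in> {..0} \<rightarrow> {0..1} \<and>
     continuous_on {..0} rL \<and>
     (\<forall>a<0. rL piecewise_C1_differentiable_on {a..0}) \<and>
     mono_on {..0} rL \<and>
     rL 0 = 1 \<and>
     (\<exists>x\<le>0. rL x \<noteq> 1)"

definition reward :: "(real \<Rightarrow> real) \<Rightarrow> (real \<Rightarrow> real) \<Rightarrow> real \<Rightarrow> real" where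
  "reward rL rR x = (if x \<le> 0 then rL x else rR x)"

definition R_T :: "real \<Rightarrow> (real \<Rightarrow> real) \<Rightarrow> (real \<Rightarrow> real) \<Rightarrow> real \<Rightarrow> real" where
  "R_T \<gamma> rL rR \<eta> =
     ((LBINT x:{..0}. rL x * exp (- (1/2) * x\<^sup>2 - \<gamma> * x))
        + (LBINT x:{0..\<eta>}. reward rL rR x * exp (- \<gamma> * x)))
     / (std_normal_cdf \<gamma> / std_normal_density \<gamma> + (LBINT x:{0..\<eta>}. exp (- \<gamma> * x)))"

text \<open>The two real branches of the Lambert W function: the principal branch, meaningful for
  arguments \<open>z \<ge> - exp (- 1)\<close>, and the lower branch, meaningful for
  \<open>- exp (- 1) \<le> z < 0\<close>. Outside these ranges the values are unspecified.\<close>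

definition lambert_W0 :: "real \<Rightarrow> real" where
  "lambert_W0 z = (THE w. - 1 \<le> w \<and> w * exp w = z)"

definition lambert_Wm1 :: "real \<Rightarrow> real" where
  "lambert_Wm1 z = (THE w. w \<le> - 1 \<and> w * exp w = z)"

end

theory Submission
  imports Defs
begin

text \<open>
  Let \<open>m = \<Phi>(-\<delta>) / \<phi>(-\<delta>)\<close> and let \<open>A\<close> be the integral of \<open>r\<^sub>L(x) exp(-x\<^sup>2/2 + \<delta>x)\<close> over the
  nonpositive reals. For \<open>\<gamma> = -\<delta>\<close> the reward \<open>exp(-\<delta>x)\<close> cancels the weight \<open>exp(-\<gamma>x)\<close>, so
  the numerator of \<open>R\<^sub>T(\<eta>)\<close> is simply \<open>A + \<eta>\<close> and its denominator is
  \<open>m + (exp(\<delta>\<eta>) - 1)/\<delta>\<close> (lemma \<open>R_T_exponential_reward\<close>). At \<open>\<eta> = 0\<close> this gives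
  \<open>r\<^sub>0 = 1/\<delta> - A\<close>. Clearing denominators in \<open>exp(-\<delta>\<eta>) = R\<^sub>T(\<eta>)\<close> leaves
  \<open>(\<eta> - r\<^sub>0) exp(\<delta>\<eta>) = m - 1/\<delta>\<close>, which in terms of \<open>w = \<delta>(\<eta> - r\<^sub>0)\<close> is the Lambert
  equation \<open>w exp w = z\<close> (lemma \<open>threshold_equation_iff\<close>).

  Which branch is meant is decided by \<open>0 \<le> A < m < 1/\<delta>\<close>. The middle inequality
  compares \<open>A\<close> with the same integral for the constant reward 1, whose value is \<open>m\<close>
  (lemma \<open>left_reward_integral_bounds\<close>); the last one is the classical bound on the Mills
  ratio (lemma \<open>mills_ratio_less\<close>). The bound \<open>A \<ge> 0\<close> means \<open>\<delta>r\<^sub>0 \<le> 1\<close>. Hence \<open>\<eta> \<ge> 0\<close>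
  forces \<open>w \<ge> -\<delta>r\<^sub>0 \<ge> -1\<close>, and there \<open>w exp w\<close> is injective: every solution is given by
  the principal branch. Conversely \<open>A < m < 1/\<delta>\<close> says that \<open>z\<close> lies strictly between the
  values of \<open>w exp w\<close> at \<open>-\<delta>r\<^sub>0\<close> and at 0, so the principal branch takes a value in
  \<open>(-\<delta>r\<^sub>0, 0)\<close>, which is a positive \<open>\<eta>\<close>. The lower branch has \<open>w \<le> -1\<close>, hence
  \<open>r\<^sub>0 + w/\<delta> \<le> r\<^sub>0 - 1/\<delta> = -A \<le> 0\<close>, and it is excluded.
\<close>

section \<open>The real branches of the Lambert W function\<close>

lemma strict_mono_on_mult_exp: "strict_mono_on {- 1..} (\<lambda>w::real. w * exp w)"
proof (rule strict_mono_onI)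
  fix r s :: real assume "r \<in> {- 1..}" "s \<in> {- 1..}" "r < s"
  then show "r * exp r < s * exp s"
  proof (intro DERIV_pos_imp_increasing_open[of r s "\<lambda>w. w * exp w"])
    fix x assume "r < x" "x < s"
    have "((\<lambda>w. w * exp w) has_real_derivative (x + 1) * exp x) (at x)"
      by (auto intro!: derivative_eq_intros simp: algebra_simps)
    then show "\<exists>y. ((\<lambda>w. w * exp w) has_real_derivative y) (at x) \<and> 0 < y"
      using \<open>r < x\<close> \<open>r \<in> {- 1..}\<close> by (intro exI conjI) auto
  qed (auto intro!: continuous_intros)
qed

lemma strict_antimono_on_mult_exp: "strict_antimono_on {..- 1} (\<lambda>w::real. w * exp w)"
proof (rule monotone_onI)
  fix r s :: real assume "r \<in> {..- 1}" "s \<in> {..- 1}" "r < s"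
  then show "r * exp r > s * exp s"
  proof (intro DERIV_neg_imp_decreasing_open[of r s "\<lambda>w. w * exp w"])
    fix x assume "r < x" "x < s"
    have "((\<lambda>w. w * exp w) has_real_derivative (x + 1) * exp x) (at x)"
      by (auto intro!: derivative_eq_intros simp: algebra_simps)
    then show "\<exists>y. ((\<lambda>w. w * exp w) has_real_derivative y) (at x) \<and> y < 0"
      using \<open>x < s\<close> \<open>s \<in> {..- 1}\<close> by (intro exI conjI) (auto simp: mult_less_0_iff)
  qed (auto intro!: continuous_intros)
qed

lemma lambert_W0_mult_exp:
  assumes "- 1 \<le> w"
  shows "lambert_W0 (w * exp w) = w"
  unfolding lambert_W0_def using assms
  by (intro the_equality) (auto dest: strict_mono_on_eqD[OF strict_mono_on_mult_exp])

text \<open>A definite description says nothing about its value until the described object is known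
  to exist, so this bound needs the surjectivity of \<open>w exp w\<close> from \<open>(-\<infinity>, -1]\<close> onto
  \<open>[-1/e, 0)\<close>, which comes from the intermediate value theorem.\<close>

lemma lambert_Wm1_le:
  assumes "- exp (- 1) \<le> z" "z < 0"
  shows "lambert_Wm1 z \<le> - 1"
proof -
  \<comment> \<open>The left end point for the intermediate value theorem: since \<open>exp (- u)\<close> is at least
    \<open>u\<^sup>2 / 2\<close>, any \<open>u < 0\<close> with \<open>z u \<ge> 2\<close> satisfies \<open>u exp u \<ge> z\<close>. The summand \<open>- 1\<close>
    also puts \<open>u\<close> below \<open>- 1\<close>.\<close>
  define u where "u = - 1 + 2 / z"
  have u: "u \<le> - 1" using assms(2) by (simp add: u_def divide_nonneg_neg)
  have "z \<le> u * exp u"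
  proof -
    have "(- u)\<^sup>2 / 2 \<le> exp (- u)"
      using exp_lower_Taylor_quadratic[of "- u"] u by simp
    moreover have "z * u\<^sup>2 \<le> 2 * u"
    proof -
      have "z * u \<ge> 2" using assms(2) by (simp add: u_def algebra_simps)
      then have "u * (z * u) \<le> u * 2" using u by (intro mult_left_mono_neg) auto
      then show ?thesis by (simp add: power2_eq_square algebra_simps)
    qed
    moreover have "z * exp (- u) \<le> z * ((- u)\<^sup>2 / 2)"
      using calculation(1) assms(2) by (intro mult_left_mono_neg) auto
    ultimately have "z * exp (- u) \<le> u" by simp
    then have "z * exp (- u) * exp u \<le> u * exp u" by (intro mult_right_mono) auto
    then show ?thesis by (simp add: mult.assoc flip: exp_add)
  qed
  moreover have "continuous_on {u..- 1} (\<lambda>w::real. w * exp w)" by (intro continuous_intros)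
  ultimately obtain w where w: "w \<le> - 1" "w * exp w = z"
    using IVT2'[of "\<lambda>w. w * exp w" "- 1" z u] u assms(1) by auto
  have "inj_on (\<lambda>w::real. w * exp w) {..- 1}"
    by (rule linorder_inj_onI')
      (use monotone_onD[OF strict_antimono_on_mult_exp] in \<open>metis less_irrefl\<close>)
  then have "lambert_Wm1 z = w"
    unfolding lambert_Wm1_def using w by (intro the_equality) (auto dest: inj_onD)
  with w show ?thesis by simp
qed

section \<open>Gaussian and exponential integrals on the negative half-line\<close>

lemma set_integral_less:
  fixes f g :: "'a \<Rightarrow> real"
  assumes f: "set_integrable M S f" and g: "set_integrable M S g"
    and T: "T \<in> sets M" "T \<subseteq> S" "emeasure M T \<noteq> 0"
    and le: "\<And>x. x \<in> S \<Longrightarrow> f x \<le> g x" and less: "\<And>x. x \<in> T \<Longrightarrow> f x < g x"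
  shows "(LINT x:S|M. f x) < (LINT x:S|M. g x)"
proof (rule ccontr)
  assume "\<not> ?thesis"
  moreover have "(LINT x:S|M. f x) \<le> (LINT x:S|M. g x)"
    by (rule set_integral_mono[OF f g le])
  ultimately have 0: "(LINT x:S|M. g x - f x) = 0"
    using set_integral_diff(2)[OF g f] by simp
  have "set_integrable M S (\<lambda>x. g x - f x)" by (rule set_integral_diff(1)[OF g f])
  then have "AE x in M. indicator S x *\<^sub>R (g x - f x) = 0"
    using 0 le unfolding set_lebesgue_integral_def set_integrable_def
    by (subst (asm) integral_nonneg_eq_0_iff_AE) (auto simp: indicator_def)
  then have "AE x in M. x \<notin> T"
    by eventually_elim (use T less in \<open>force simp: indicator_def\<close>)
  then show False
    using T sets.sets_into_space[OF T(1)] by (subst (asm) AE_iff_measurable[of T]) auto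
qed

lemma emeasure_lborel_atMost [simp]: "emeasure lborel {..a::real} = \<infinity>"
proof -
  have "ennreal b \<le> emeasure lborel {..a}" if "b \<ge> 0" for b
  proof -
    have "emeasure lborel {a - b..a} \<le> emeasure lborel {..a}" by (intro emeasure_mono) auto
    then show ?thesis using that by simp
  qed
  from this[of "enn2real (emeasure lborel {..a}) + 1"] show ?thesis
    by (cases "emeasure lborel {..a}") (auto simp: ennreal_le_iff)
qed

lemma has_bochner_integral_exp_atMost_0:
  fixes \<delta> :: real
  assumes "\<delta> > 0"
  shows "has_bochner_integral lborel (\<lambda>x. indicator {..0} x *\<^sub>R exp (\<delta> * x)) (1 / \<delta>)"
proof -
  have "(\<integral>\<^sup>+x. ennreal (exp (- \<delta> * x)) * indicator {0..} x \<partial>lborel)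
      = ennreal (0 - (- exp (- \<delta> * 0) / \<delta>))"
  proof (rule nn_integral_FTC_atLeast)
    show "((\<lambda>x. - exp (- \<delta> * x) / \<delta>) has_real_derivative exp (- \<delta> * x)) (at x)" for x
      using assms by (auto intro!: derivative_eq_intros)
    have "filterlim (\<lambda>x. \<delta> * x) at_top at_top"
      by (rule filterlim_tendsto_pos_mult_at_top[OF tendsto_const assms filterlim_ident])
    then have "((\<lambda>x. exp (- (\<delta> * x))) \<longlongrightarrow> 0) at_top"
      by (intro filterlim_compose[OF exp_at_bot] filterlim_uminus_at_bot[THEN iffD2]) simp
    then have "((\<lambda>x. - exp (- (\<delta> * x)) / \<delta>) \<longlongrightarrow> - 0 / \<delta>) at_top"
      using assms by (intro tendsto_intros) auto
    then show "((\<lambda>x. - exp (- \<delta> * x) / \<delta>) \<longlongrightarrow> 0) at_top" by simp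
  qed auto
  then have "has_bochner_integral lborel (\<lambda>x. indicator {0..} x *\<^sub>R exp (- \<delta> * x)) (1 / \<delta>)"
    using assms by (intro has_bochner_integral_nn_integral)
      (auto intro!: nn_integral_cong simp: indicator_def elim!: back_subst[of "\<lambda>y. y = _"])
  then show ?thesis
    by (subst lborel_has_bochner_integral_real_affine_iff[where c = "- 1" and t = 0])
      (auto simp: indicator_def)
qed

text \<open>Completing the square: up to the factor \<open>\<phi>(\<gamma>)\<close>, the integrand is \<open>\<phi>(\<gamma> + x)\<close>, so the
  integral is a translate of the one defining \<open>\<Phi>(\<gamma>)\<close>.\<close>

lemma has_bochner_integral_mills_ratio:
  "has_bochner_integral lborel (\<lambda>x. indicator {..0} x *\<^sub>R exp (- (1/2) * x\<^sup>2 - \<gamma> * x))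
     (std_normal_cdf \<gamma> / std_normal_density \<gamma>)"
proof -
  interpret real_distribution std_normal_distribution by (rule real_dist_normal_dist)
  have pos: "std_normal_density \<gamma> > 0" by (rule normal_density_pos) simp
  have "integrable std_normal_distribution (indicat_real {..\<gamma>})"
    by (auto simp: emeasure_eq_measure intro!: integrable_real_indicator)
  then have "integrable lborel (\<lambda>x. std_normal_density x *\<^sub>R indicat_real {..\<gamma>} x)"
    by (subst (asm) integrable_density) auto
  moreover have "(LBINT x. std_normal_density x *\<^sub>R indicat_real {..\<gamma>} x) = std_normal_cdf \<gamma>"
    by (subst integral_density[symmetric]) (auto simp: cdf_def)
  ultimately have "has_bochner_integral lborel (\<lambda>x. std_normal_density x *\<^sub>R indicat_real {..\<gamma>} x)
      (std_normal_cdf \<gamma>)"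
    by (simp add: has_bochner_integral_iff)
  then have "has_bochner_integral lborel
      (\<lambda>x. std_normal_density (\<gamma> + 1 * x) *\<^sub>R indicat_real {..\<gamma>} (\<gamma> + 1 * x)) (std_normal_cdf \<gamma>)"
    using lborel_has_bochner_integral_real_affine_iff[where c = 1 and t = \<gamma>] by fastforce
  then have "has_bochner_integral lborel
      (\<lambda>x. std_normal_density (\<gamma> + 1 * x) *\<^sub>R indicat_real {..\<gamma>} (\<gamma> + 1 * x) / std_normal_density \<gamma>)
      (std_normal_cdf \<gamma> / std_normal_density \<gamma>)"
    using pos by (intro has_bochner_integral_divide) auto
  moreover have "std_normal_density (\<gamma> + x) / std_normal_density \<gamma> = exp (- (1/2) * x\<^sup>2 - \<gamma> * x)" for x
    by (simp add: std_normal_density_def field_simps power2_eq_square add_divide_distrib flip: exp_add)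
  then have "std_normal_density (\<gamma> + 1 * x) *\<^sub>R indicat_real {..\<gamma>} (\<gamma> + 1 * x) / std_normal_density \<gamma>
      = indicator {..0} x *\<^sub>R exp (- (1/2) * x\<^sup>2 - \<gamma> * x)" for x
    by (auto simp: indicator_def)
  ultimately show ?thesis by simp
qed

text \<open>Dropping the Gaussian factor \<open>exp(-x\<^sup>2/2) \<le> 1\<close> from the integral representation of the Mills
  ratio leaves the exponential integral with value \<open>1/\<delta>\<close>.\<close>

lemma mills_ratio_less:
  assumes "\<delta> > 0"
  shows "std_normal_cdf (- \<delta>) / std_normal_density (- \<delta>) < 1 / \<delta>"
proof -
  have "(LBINT x:{..0}. exp (- (1/2) * x\<^sup>2 - (- \<delta>) * x)) < (LBINT x:{..0}. exp (\<delta> * x))"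
    using has_bochner_integral_mills_ratio[of "- \<delta>"] has_bochner_integral_exp_atMost_0[OF assms]
    by (intro set_integral_less[where T = "{..- 1}"])
      (auto simp: set_integrable_def has_bochner_integral_iff)
  then show ?thesis
    using has_bochner_integral_mills_ratio[of "- \<delta>"] has_bochner_integral_exp_atMost_0[OF assms]
    unfolding set_lebesgue_integral_def has_bochner_integral_iff by simp
qed

text \<open>The upper bound is the value of the integral for the constant reward 1. It is strict because
  a nondecreasing reward that is below 1 at one point is below 1 on the whole half-line to
  the left of it.\<close>

lemma left_reward_integral_bounds:
  fixes \<gamma> :: real
  assumes "left_reward rL"
  defines "A \<equiv> LBINT x:{..0}. rL x * exp (- (1/2) * x\<^sup>2 - \<gamma> * x)"
  shows "0 \<le> A" and "A < std_normal_cdf \<gamma> / std_normal_density \<gamma>"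
proof -
  let ?w = "\<lambda>x. exp (- (1/2) * x\<^sup>2 - \<gamma> * x)"
  have rL: "0 \<le> rL x" "rL x \<le> 1" if "x \<le> 0" for x
    using assms(1) that unfolding left_reward_def Pi_iff by auto
  obtain x0 where x0: "x0 \<le> 0" "rL x0 \<noteq> 1"
    using assms(1) unfolding left_reward_def by auto
  have mono: "mono_on {..0} rL" and cont: "continuous_on {..0} rL"
    using assms(1) unfolding left_reward_def by auto
  show "0 \<le> A"
    unfolding A_def set_lebesgue_integral_def using rL
    by (intro integral_nonneg_AE) (auto simp: indicator_def)
  have w: "set_integrable lborel {..0} ?w"
    using has_bochner_integral_mills_ratio[of \<gamma>] by (simp add: set_integrable_def has_bochner_integral_iff)
  have "set_integrable lborel {..0} (\<lambda>x. rL x * ?w x)"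
  proof (rule set_integrable_bound[OF w])
    have "continuous_on {..0} (\<lambda>x. rL x * ?w x)" by (intro continuous_intros cont)
    from borel_measurable_continuous_on_indicator[OF _ this]
    show "set_borel_measurable lborel {..0} (\<lambda>x. rL x * ?w x)"
      unfolding set_borel_measurable_def by simp
  qed (use rL in \<open>auto simp: abs_mult mult_le_cancel_right1\<close>)
  moreover have "rL x * ?w x < ?w x" if "x \<in> {..x0}" for x
  proof -
    have "rL x \<le> rL x0" using mono_onD[OF mono] that x0 by auto
    then have "rL x < 1" using rL(2)[of x0] x0 by simp
    then show ?thesis by simp
  qed
  ultimately have "A < (LBINT x:{..0}. ?w x)"
    unfolding A_def using w x0 rL
    by (intro set_integral_less[where T = "{..x0}"]) (auto simp: mult_le_cancel_right1)
  then show "A < std_normal_cdf \<gamma> / std_normal_density \<gamma>"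
    using has_bochner_integral_mills_ratio[of \<gamma>]
    unfolding set_lebesgue_integral_def has_bochner_integral_iff by simp
qed

section \<open>The threshold equation\<close>

lemma R_T_exponential_reward:
  assumes "\<delta> > 0" "rL 0 = 1" "\<And>x. x \<ge> 0 \<Longrightarrow> rR x = exp (- \<delta> * x)" "\<eta> \<ge> 0"
  shows "R_T (- \<delta>) rL rR \<eta> =
    ((LBINT x:{..0}. rL x * exp (- (1/2) * x\<^sup>2 + \<delta> * x)) + \<eta>)
    / (std_normal_cdf (- \<delta>) / std_normal_density (- \<delta>) + (exp (\<delta> * \<eta>) - 1) / \<delta>)"
proof -
  have "(LBINT x:{0..\<eta>}. reward rL rR x * exp (\<delta> * x)) = (LBINT x:{0..\<eta>}. 1)"
    using assms(2,3) by (intro set_lebesgue_integral_cong) (auto simp: reward_def simp flip: exp_add)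
  also have "\<dots> = \<eta>"
    using assms(4) by (simp add: set_lebesgue_integral_def)
  finally have 1: "(LBINT x:{0..\<eta>}. reward rL rR x * exp (\<delta> * x)) = \<eta>" .
  have "(LBINT x:{0..\<eta>}. exp (\<delta> * x)) = exp (\<delta> * \<eta>) / \<delta> - exp (\<delta> * 0) / \<delta>"
    unfolding set_lebesgue_integral_def using assms(1,4)
    by (intro integral_FTC_atLeastAtMost)
      (auto intro!: derivative_eq_intros continuous_intros
        simp flip: has_real_derivative_iff_has_vector_derivative)
  then show ?thesis
    unfolding R_T_def by (simp add: 1 diff_divide_distrib)
qed

text \<open>The factor \<open>\<delta> exp(-\<delta>r\<^sub>0)\<close> turns \<open>(\<eta> - r\<^sub>0) exp(\<delta>\<eta>)\<close> into the form \<open>w exp w\<close> with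
  \<open>w = \<delta>(\<eta> - r\<^sub>0)\<close>.\<close>

lemma threshold_equation_iff:
  fixes \<delta> m A \<eta> :: real
  assumes "\<delta> > 0" "m > 0" "\<eta> \<ge> 0"
  defines "r\<^sub>0 \<equiv> 1 / \<delta> - A"
  shows "exp (- \<delta> * \<eta>) = (A + \<eta>) / (m + (exp (\<delta> * \<eta>) - 1) / \<delta>) \<longleftrightarrow>
    \<delta> * (\<eta> - r\<^sub>0) * exp (\<delta> * (\<eta> - r\<^sub>0)) = \<delta> * exp (- \<delta> * r\<^sub>0) * (m - 1 / \<delta>)"
proof -
  let ?E = "exp (\<delta> * \<eta>)"
  have "?E \<ge> 1" using assms by simp
  then have pos: "m + (?E - 1) / \<delta> > 0" using assms by (intro add_pos_nonneg) auto
  have "exp (- \<delta> * \<eta>) = (A + \<eta>) / (m + (?E - 1) / \<delta>) \<longleftrightarrow>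
      m + (?E - 1) / \<delta> = (A + \<eta>) * ?E"
    using pos by (simp add: exp_minus field_simps)
  also have "\<dots> \<longleftrightarrow> (\<eta> - r\<^sub>0) * ?E = m - 1 / \<delta>"
    unfolding r\<^sub>0_def by (auto simp: algebra_simps diff_divide_distrib)
  also have "\<dots> \<longleftrightarrow> (\<delta> * exp (- \<delta> * r\<^sub>0)) * ((\<eta> - r\<^sub>0) * ?E) = (\<delta> * exp (- \<delta> * r\<^sub>0)) * (m - 1 / \<delta>)"
    using assms(1) by simp
  also have "(\<delta> * exp (- \<delta> * r\<^sub>0)) * ((\<eta> - r\<^sub>0) * ?E) = \<delta> * (\<eta> - r\<^sub>0) * exp (\<delta> * (\<eta> - r\<^sub>0))"
    by (simp add: right_diff_distrib exp_diff exp_minus field_simps)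
  finally show ?thesis .
qed

theorem proposition12:
  fixes \<delta> \<gamma> a\<^sub>0 r\<^sub>0 z :: real and r rL rR :: "real \<Rightarrow> real"
  assumes "\<delta> > 0"
    and "left_reward rL"
    and "\<And>x. x \<ge> 0 \<Longrightarrow> rR x = exp (- \<delta> * x)"
    and "r = reward rL rR"
    and "\<gamma> = - \<delta>"
    and "a\<^sub>0 = 1 / (std_normal_cdf \<gamma> / std_normal_density \<gamma> - 1 / \<delta>)"
    and "r\<^sub>0 = 1 / \<delta> - std_normal_cdf \<gamma> / std_normal_density \<gamma> * R_T \<gamma> rL rR 0"
    and "z = \<delta> * exp (- \<delta> * r\<^sub>0) / a\<^sub>0"
  shows "(\<exists>!W. W \<in> {lambert_W0, lambert_Wm1} \<and> W z * exp (W z) = z \<and> r\<^sub>0 + 1 / \<delta> * W z > 0) \<and>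
         (\<forall>W \<in> {lambert_W0, lambert_Wm1}.
            W z * exp (W z) = z \<and> r\<^sub>0 + 1 / \<delta> * W z > 0 \<longrightarrow>
            {\<eta>. \<eta> \<ge> 0 \<and> r \<eta> = R_T \<gamma> rL rR \<eta>} = {r\<^sub>0 + 1 / \<delta> * W z})"
proof -
  define m where "m = std_normal_cdf (- \<delta>) / std_normal_density (- \<delta>)"
  define A where "A = (LBINT x:{..0}. rL x * exp (- (1/2) * x\<^sup>2 + \<delta> * x))"
  have rL0: "rL 0 = 1" using assms(2) by (simp add: left_reward_def)
  have A: "0 \<le> A" "A < m"
    using left_reward_integral_bounds[OF assms(2), of "- \<delta>"] by (simp_all add: A_def m_def)
  have m: "m < 1 / \<delta>" using mills_ratio_less[OF assms(1)] by (simp add: m_def)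
  have R_T: "R_T \<gamma> rL rR \<eta> = (A + \<eta>) / (m + (exp (\<delta> * \<eta>) - 1) / \<delta>)" if "\<eta> \<ge> 0" for \<eta>
    using R_T_exponential_reward[of \<delta> rL rR \<eta>, OF assms(1) rL0 assms(3) that] by (simp add: assms(5) A_def m_def)
  have r0: "r\<^sub>0 = 1 / \<delta> - A"
    using R_T[of 0] A by (simp add: assms(5,7) flip: m_def)
  have z: "z = \<delta> * exp (- \<delta> * r\<^sub>0) * (m - 1 / \<delta>)"
    by (simp add: assms(5,6,8) m_def)
  have solution_iff: "r \<eta> = R_T \<gamma> rL rR \<eta> \<longleftrightarrow> \<delta> * (\<eta> - r\<^sub>0) * exp (\<delta> * (\<eta> - r\<^sub>0)) = z"
    if "\<eta> \<ge> 0" for \<eta>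
  proof -
    have "r \<eta> = exp (- \<delta> * \<eta>)"
      using that rL0 assms(3)[of \<eta>] by (auto simp: assms(4) reward_def)
    then show ?thesis
      using threshold_equation_iff[OF assms(1) _ that, of m A] A R_T[OF that]
      by (simp add: z r0)
  qed
  have z_neg: "z < 0" using m assms(1) by (simp add: z mult_pos_neg)
  have dr0: "- \<delta> * r\<^sub>0 \<ge> - 1" using A(1) assms(1) by (simp add: r0 algebra_simps)
  \<comment> \<open>At \<open>\<eta> = 0\<close>, that is \<open>w = - \<delta> r\<^sub>0\<close>, the function \<open>w exp w\<close> is still below \<open>z\<close>; at
    \<open>w = 0\<close> it exceeds the negative \<open>z\<close>. So a solution lies in between.\<close>
  have "- \<delta> * r\<^sub>0 * exp (- \<delta> * r\<^sub>0) < z"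
  proof -
    have "\<delta> * exp (- \<delta> * r\<^sub>0) * (- r\<^sub>0) < \<delta> * exp (- \<delta> * r\<^sub>0) * (m - 1 / \<delta>)"
      using A(2) assms(1) by (intro mult_strict_left_mono) (auto simp: r0)
    then show ?thesis by (simp add: z mult_ac)
  qed
  moreover have "r\<^sub>0 > 0" using A m by (simp add: r0)
  moreover have "continuous_on {- \<delta> * r\<^sub>0..0} (\<lambda>w. w * exp w)" by (intro continuous_intros)
  ultimately obtain w where w: "- \<delta> * r\<^sub>0 \<le> w" "w * exp w = z"
    using IVT'[of "\<lambda>w. w * exp w" "- \<delta> * r\<^sub>0" z 0] z_neg assms(1) by auto
  have "w \<noteq> - \<delta> * r\<^sub>0" using w \<open>- \<delta> * r\<^sub>0 * exp (- \<delta> * r\<^sub>0) < z\<close> by auto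
  then have w_gt: "- \<delta> * r\<^sub>0 < w" using w by simp
  have W0: "lambert_W0 z = w" using lambert_W0_mult_exp[of w] w dr0 by simp
  have W0_pos: "r\<^sub>0 + 1 / \<delta> * lambert_W0 z > 0"
    using w_gt assms(1) by (simp add: W0 field_simps)
  have "- exp (- 1) \<le> z"
    using strict_mono_onD[OF strict_mono_on_mult_exp, of "- 1" w] w_gt w dr0 by simp
  then have "lambert_Wm1 z \<le> - 1" using z_neg by (rule lambert_Wm1_le)
  then have "1 / \<delta> * lambert_Wm1 z \<le> 1 / \<delta> * (- 1)"
    using assms(1) by (intro mult_left_mono) auto
  then have Wm1: "\<not> r\<^sub>0 + 1 / \<delta> * lambert_Wm1 z > 0" using A(1) by (simp add: r0)
  have "{\<eta>. \<eta> \<ge> 0 \<and> r \<eta> = R_T \<gamma> rL rR \<eta>} = {r\<^sub>0 + 1 / \<delta> * lambert_W0 z}"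
  proof (intro equalityI subsetI)
    fix \<eta> assume "\<eta> \<in> {\<eta>. \<eta> \<ge> 0 \<and> r \<eta> = R_T \<gamma> rL rR \<eta>}"
    then have \<eta>: "\<eta> \<ge> 0" "\<delta> * (\<eta> - r\<^sub>0) * exp (\<delta> * (\<eta> - r\<^sub>0)) = z"
      using solution_iff by auto
    have "0 \<le> \<delta> * \<eta>" using \<eta>(1) assms(1) by simp
    then have "- 1 \<le> \<delta> * (\<eta> - r\<^sub>0)" using dr0 by (simp add: algebra_simps)
    then have "lambert_W0 z = \<delta> * (\<eta> - r\<^sub>0)" using lambert_W0_mult_exp \<eta>(2) by metis
    then show "\<eta> \<in> {r\<^sub>0 + 1 / \<delta> * lambert_W0 z}" using assms(1) by simp
  next
    fix \<eta> assume "\<eta> \<in> {r\<^sub>0 + 1 / \<delta> * lambert_W0 z}"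
    then have \<eta>: "\<eta> = r\<^sub>0 + 1 / \<delta> * w" by (simp add: W0)
    then have "\<delta> * (\<eta> - r\<^sub>0) = w" using assms(1) by simp
    then show "\<eta> \<in> {\<eta>. \<eta> \<ge> 0 \<and> r \<eta> = R_T \<gamma> rL rR \<eta>}"
      using solution_iff[of \<eta>] w(2) W0_pos \<eta> by (simp add: W0)
  qed
  moreover have "\<exists>!W. W \<in> {lambert_W0, lambert_Wm1} \<and> W z * exp (W z) = z \<and> r\<^sub>0 + 1 / \<delta> * W z > 0"
    using W0_pos Wm1 w(2) W0 by (intro ex1I[of _ lambert_W0]) auto
  ultimately show ?thesis using Wm1 by auto
qed

end
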